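(* Let $g=(A,w)\in\mathrm{SU}(n)\ltimes\mathbb{C}^n$. Suppose $-1$ is an eigenvalue of $A$. Then the following are equivalent. (1) $g$ is strongly reversible in $\mathrm{SU}(n)\ltimes\mathbb{C}^n$. (2) The characteristic polynomial of $A$ is self-dual.
   Context: $\mathrm{SU}(n)$ is the group of complex unitary $n\times n$ matrices of determinant $1$. Elements of $\mathrm{SU}(n)\ltimes\mathbb{C}^n$ are pairs $(A,w)$ with $A\in\mathrm{SU}(n)$, $w\in\mathbb{C}^n$, acting as the affine maps $z\mapsto Az+w$ of $\mathbb{C}^n$; the group operation is composition. An element $g$ of a group $G$ is strongly reversible in $G$ if there is $h\in G$ with $h^2=1$ and $hgh^{-1}=g^{-1}$. For a unitary matrix $A$, the characteristic polynomial of $A$ is self-dual if whenever $\lambda\neq\pm1$ is a root of it, so is $\lambda^{-1}$, with the same multiplicity. *)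

theory Defs
  imports
    "Jordan_Normal_Form.Schur_Decomposition"
    "HOL-Algebra.Group"
begin

definition special_unitary :: "nat \<Rightarrow> complex mat set" where
  "special_unitary n = {A \<in> carrier_mat n n. mat_adjoint A * A = 1\<^sub>m n \<and> det A = 1}"

definition affine_map :: "complex mat \<times> complex vec \<Rightarrow> complex vec \<Rightarrow> complex vec" where
  "affine_map g z = fst g *\<^sub>v z + snd g"

text \<open>The product of \<open>(A, v)\<close> and \<open>(B, w)\<close> represents the composition of their affine maps,
  \<open>z \<mapsto> A (B z + w) + v\<close>; see \<open>affine_map_mult\<close> and \<open>affine_map_inj\<close> below.\<close>

definition SU_affine :: "nat \<Rightarrow> (complex mat \<times> complex vec) monoid" where
  "SU_affine n = \<lparr>
     carrier = special_unitary n \<times> carrier_vec n,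
     monoid.mult = (\<lambda>(A, v) (B, w). (A * B, A *\<^sub>v w + v)),
     one = (1\<^sub>m n, 0\<^sub>v n)\<rparr>"

definition strongly_reversible :: "('a, 'b) monoid_scheme \<Rightarrow> 'a \<Rightarrow> bool" where
  "strongly_reversible G g \<longleftrightarrow>
     (\<exists>h \<in> carrier G. h [^]\<^bsub>G\<^esub> (2::nat) = \<one>\<^bsub>G\<^esub> \<and> h \<otimes>\<^bsub>G\<^esub> g \<otimes>\<^bsub>G\<^esub> inv\<^bsub>G\<^esub> h = inv\<^bsub>G\<^esub> g)"

text \<open>\<open>order x p\<close> is the multiplicity of the root \<open>x\<close>. The polynomials concerned are
  characteristic polynomials of unitary matrices, so \<open>0\<close> is not a root and the
  convention \<open>inverse 0 = 0\<close> plays no role.\<close>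

definition self_dual :: "complex poly \<Rightarrow> bool" where
  "self_dual p \<longleftrightarrow>
     (\<forall>x. poly p x = 0 \<and> x \<noteq> 1 \<and> x \<noteq> -1 \<longrightarrow>
        poly p (inverse x) = 0 \<and> Polynomial.order (inverse x) p = Polynomial.order x p)"

lemma mat_adjoint_carrier:
  "A \<in> carrier_mat n n \<Longrightarrow> mat_adjoint A \<in> carrier_mat n n"
  by (auto simp: mat_adjoint_def)

lemma mat_adjoint_index:
  fixes A :: "complex mat"
  assumes "A \<in> carrier_mat n n" "i < n" "j < n"
  shows "mat_adjoint A $$ (i, j) = cnj (A $$ (j, i))"
  using assms by (simp add: mat_adjoint_def mat_of_rows_def)

lemma mat_adjoint_mult:
  fixes A B :: "complex mat"
  assumes A: "A \<in> carrier_mat n n" and B: "B \<in> carrier_mat n n"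
  shows "mat_adjoint (A * B) = mat_adjoint B * mat_adjoint A"
proof (rule eq_matI)
  have c: "A * B \<in> carrier_mat n n" using A B by simp
  note d = mat_adjoint_carrier[OF A] mat_adjoint_carrier[OF B] mat_adjoint_carrier[OF c]
  show "dim_row (mat_adjoint (A * B)) = dim_row (mat_adjoint B * mat_adjoint A)"
       "dim_col (mat_adjoint (A * B)) = dim_col (mat_adjoint B * mat_adjoint A)"
    using d by auto
  fix i j
  assume "i < dim_row (mat_adjoint B * mat_adjoint A)" "j < dim_col (mat_adjoint B * mat_adjoint A)"
  then have ij: "i < n" "j < n" using d by auto
  have "(mat_adjoint B * mat_adjoint A) $$ (i, j)
      = (\<Sum>k<n. mat_adjoint B $$ (i, k) * mat_adjoint A $$ (k, j))"
    using d ij by (simp add: scalar_prod_def lessThan_atLeast0)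
  also have "\<dots> = (\<Sum>k<n. cnj (B $$ (k, i)) * cnj (A $$ (j, k)))"
    using ij by (intro sum.cong) (auto simp: mat_adjoint_index[OF A] mat_adjoint_index[OF B])
  also have "\<dots> = cnj ((A * B) $$ (j, i))"
    using A B ij by (simp add: scalar_prod_def lessThan_atLeast0 mult.commute)
  finally show "mat_adjoint (A * B) $$ (i, j) = (mat_adjoint B * mat_adjoint A) $$ (i, j)"
    using ij by (simp add: mat_adjoint_index[OF c])
qed

lemma mat_adjoint_adjoint:
  fixes A :: "complex mat"
  assumes A: "A \<in> carrier_mat n n"
  shows "mat_adjoint (mat_adjoint A) = A"
  using A mat_adjoint_carrier[OF A] mat_adjoint_carrier[OF mat_adjoint_carrier[OF A]]
  by (intro eq_matI)
     (auto simp: mat_adjoint_index[OF A] mat_adjoint_index[OF mat_adjoint_carrier[OF A]])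

lemma mat_adjoint_one: "mat_adjoint (1\<^sub>m n :: complex mat) = 1\<^sub>m n"
  using mat_adjoint_carrier[OF one_carrier_mat, of n, where 'a = complex]
  by (intro eq_matI) (auto simp: mat_adjoint_index[OF one_carrier_mat])

lemma special_unitary_mult:
  assumes "A \<in> special_unitary n" "B \<in> special_unitary n"
  shows "A * B \<in> special_unitary n"
proof -
  have A: "A \<in> carrier_mat n n" "mat_adjoint A * A = 1\<^sub>m n" "det A = 1"
    and B: "B \<in> carrier_mat n n" "mat_adjoint B * B = 1\<^sub>m n" "det B = 1"
    using assms by (auto simp: special_unitary_def)
  note a = mat_adjoint_carrier[OF A(1)] and b = mat_adjoint_carrier[OF B(1)]
  have "mat_adjoint (A * B) * (A * B) = mat_adjoint B * (mat_adjoint A * (A * B))"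
    using A(1) B(1) a b by (simp add: mat_adjoint_mult[OF A(1) B(1)] assoc_mult_mat[of _ n n _ n _ n])
  also have "mat_adjoint A * (A * B) = B"
    using A B a by (simp flip: assoc_mult_mat[of _ n n _ n _ n])
  finally show ?thesis
    using A B by (auto simp: special_unitary_def det_mult)
qed

lemma special_unitary_one: "1\<^sub>m n \<in> special_unitary n"
  by (auto simp: special_unitary_def mat_adjoint_one)

lemma special_unitary_adjoint:
  assumes "A \<in> special_unitary n"
  shows "mat_adjoint A \<in> special_unitary n" "mat_adjoint A * A = 1\<^sub>m n" "A * mat_adjoint A = 1\<^sub>m n"
proof -
  have A: "A \<in> carrier_mat n n" "mat_adjoint A * A = 1\<^sub>m n" "det A = 1"
    using assms by (auto simp: special_unitary_def)
  note a = mat_adjoint_carrier[OF A(1)]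
  show *: "A * mat_adjoint A = 1\<^sub>m n" using mat_mult_left_right_inverse[OF a A(1) A(2)] .
  have "det (mat_adjoint A) = 1" using det_mult[OF a A(1)] A by simp
  with a * show "mat_adjoint A \<in> special_unitary n"
    by (simp add: special_unitary_def mat_adjoint_adjoint[OF A(1)])
  show "mat_adjoint A * A = 1\<^sub>m n" by (fact A(2))
qed

lemma affine_map_mult:
  assumes "g \<in> carrier (SU_affine n)" "h \<in> carrier (SU_affine n)" "z \<in> carrier_vec n"
  shows "affine_map (g \<otimes>\<^bsub>SU_affine n\<^esub> h) z = affine_map g (affine_map h z)"
proof -
  obtain A v B w where gh: "g = (A, v)" "h = (B, w)"
    and c: "A \<in> carrier_mat n n" "B \<in> carrier_mat n n" "v \<in> carrier_vec n" "w \<in> carrier_vec n"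
    using assms by (auto simp: SU_affine_def special_unitary_def)
  have Bz: "B *\<^sub>v z \<in> carrier_vec n" and ABz: "A *\<^sub>v (B *\<^sub>v z) \<in> carrier_vec n"
    and Aw: "A *\<^sub>v w \<in> carrier_vec n"
    using c assms(3) by auto
  show ?thesis
    using c assms(3) ABz Aw
    by (simp add: gh SU_affine_def affine_map_def mult_add_distrib_mat_vec[OF c(1) Bz c(4)]
        assoc_add_vec[OF ABz Aw c(3)] assoc_mult_mat_vec[OF c(1,2) assms(3)])
qed

lemma affine_map_inj:
  assumes "g \<in> carrier (SU_affine n)" "h \<in> carrier (SU_affine n)"
    and eq: "\<And>z. z \<in> carrier_vec n \<Longrightarrow> affine_map g z = affine_map h z"
  shows "g = h"
proof -
  obtain A v B w where gh: "g = (A, v)" "h = (B, w)"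
    and c: "A \<in> carrier_mat n n" "B \<in> carrier_mat n n" "v \<in> carrier_vec n" "w \<in> carrier_vec n"
    using assms by (auto simp: SU_affine_def special_unitary_def)
  have 0: "C *\<^sub>v 0\<^sub>v n = 0\<^sub>v n" if "C \<in> carrier_mat n n" for C :: "complex mat"
    using that by (intro eq_vecI) auto
  have vw: "v = w"
    using eq[of "0\<^sub>v n"] c by (simp add: gh affine_map_def 0)
  have "A *\<^sub>v z = B *\<^sub>v z" if z: "z \<in> carrier_vec n" for z
  proof (rule eq_vecI)
    fix i assume "i < dim_vec (B *\<^sub>v z)"
    then have i: "i < n" using c by auto
    have "(A *\<^sub>v z + v) $ i = (B *\<^sub>v z + v) $ i"
      using eq[OF z] by (simp add: gh affine_map_def vw)
    then show "(A *\<^sub>v z) $ i = (B *\<^sub>v z) $ i"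
      using i c z by (simp del: index_mult_mat_vec)
  qed (use c in auto)
  then have AB: "A *\<^sub>v unit_vec n j = B *\<^sub>v unit_vec n j" for j by simp
  have "A = B"
  proof (rule eq_matI)
    fix i j assume ij: "i < dim_row B" "j < dim_col B"
    then have "(A *\<^sub>v unit_vec n j) $ i = A $$ (i, j)" "(B *\<^sub>v unit_vec n j) $ i = B $$ (i, j)"
      using c by auto
    with AB[of j] show "A $$ (i, j) = B $$ (i, j)" by simp
  qed (use c in auto)
  with vw gh show ?thesis by simp
qed

lemma group_SU_affine: "group (SU_affine n)"
proof (rule groupI)
  show mult: "g \<otimes>\<^bsub>SU_affine n\<^esub> h \<in> carrier (SU_affine n)"
    if "g \<in> carrier (SU_affine n)" "h \<in> carrier (SU_affine n)" for g h
    using that by (auto simp: SU_affine_def intro: special_unitary_mult)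
       (auto simp: special_unitary_def)
  show "\<one>\<^bsub>SU_affine n\<^esub> \<in> carrier (SU_affine n)"
    by (simp add: SU_affine_def special_unitary_one)
  have closed: "affine_map g z \<in> carrier_vec n"
    if "g \<in> carrier (SU_affine n)" "z \<in> carrier_vec n" for g z
    using that by (auto simp: SU_affine_def special_unitary_def affine_map_def)
  show "g \<otimes>\<^bsub>SU_affine n\<^esub> h \<otimes>\<^bsub>SU_affine n\<^esub> k = g \<otimes>\<^bsub>SU_affine n\<^esub> (h \<otimes>\<^bsub>SU_affine n\<^esub> k)"
    if "g \<in> carrier (SU_affine n)" "h \<in> carrier (SU_affine n)" "k \<in> carrier (SU_affine n)" for g h k
    by (rule affine_map_inj[of _ n]) (simp_all add: that mult affine_map_mult closed)
  show "\<one>\<^bsub>SU_affine n\<^esub> \<otimes>\<^bsub>SU_affine n\<^esub> g = g" if "g \<in> carrier (SU_affine n)" for g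
    using that by (auto simp: SU_affine_def special_unitary_def)
  show "\<exists>h \<in> carrier (SU_affine n). h \<otimes>\<^bsub>SU_affine n\<^esub> g = \<one>\<^bsub>SU_affine n\<^esub>"
    if g: "g \<in> carrier (SU_affine n)" for g
  proof -
    obtain A v where gA: "g = (A, v)" and A: "A \<in> special_unitary n" and v: "v \<in> carrier_vec n"
      using g by (auto simp: SU_affine_def)
    note a = special_unitary_adjoint[OF A]
    have av: "mat_adjoint A *\<^sub>v v \<in> carrier_vec n"
      using a(1) v by (auto simp: special_unitary_def)
    show ?thesis
      by (rule bexI[of _ "(mat_adjoint A, - (mat_adjoint A *\<^sub>v v))"])
         (use a av in \<open>auto simp: gA SU_affine_def\<close>)
  qed
qed

end

theory Submission
  imports Defs
begin

text \<open>\<open>g\<close> is strongly reversible iff there is an involution \<open>h\<close> such that \<open>h g\<close> is an involution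
  as well. The linear part of such an \<open>h\<close> conjugates \<open>A\<close> to its adjoint, whose eigenvalues are the
  conjugates, i.e. the inverses, of those of \<open>A\<close>. Conversely, for \<open>h\<close> take a linear involution \<open>B\<close>
  that swaps paired eigenvectors of \<open>A\<close>, recentred at a point \<open>c\<close> with \<open>A c + w = c + e\<close>, \<open>A e = e\<close>;
  since the translation part \<open>e\<close> must be reversed, \<open>B\<close> is \<open>-1\<close> on the fixed space of \<open>A\<close>,
  and the eigenvalue \<open>-1\<close> leaves a free sign by which \<open>det B = 1\<close> is arranged.\<close>

section \<open>Unitary matrices of arbitrary determinant\<close>

definition unitary_mats :: "nat \<Rightarrow> complex mat set" where
  "unitary_mats n = {U \<in> carrier_mat n n. mat_adjoint U * U = 1\<^sub>m n}"

lemma unitary_matsD: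
  assumes "U \<in> unitary_mats n"
  shows "U \<in> carrier_mat n n" "mat_adjoint U \<in> carrier_mat n n"
    "mat_adjoint U * U = 1\<^sub>m n" "U * mat_adjoint U = 1\<^sub>m n"
proof -
  show U: "U \<in> carrier_mat n n" and l: "mat_adjoint U * U = 1\<^sub>m n"
    using assms by (auto simp: unitary_mats_def)
  show a: "mat_adjoint U \<in> carrier_mat n n" by (rule mat_adjoint_carrier[OF U])
  show "U * mat_adjoint U = 1\<^sub>m n" by (rule mat_mult_left_right_inverse[OF a U l])
qed

lemma mult_mult_cancel_mat:
  fixes X :: "complex mat"
  assumes "U \<in> carrier_mat n n" "V \<in> carrier_mat n n" "V * U = 1\<^sub>m n" "X \<in> carrier_mat n k"
  shows "V * (U * X) = X"
  using assms by (simp flip: assoc_mult_mat[of V n n U n X k])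

lemma unitary_mats_mult:
  assumes "U \<in> unitary_mats n" "V \<in> unitary_mats n"
  shows "U * V \<in> unitary_mats n"
proof -
  note u = unitary_matsD[OF assms(1)] and v = unitary_matsD[OF assms(2)]
  have "mat_adjoint (U * V) * (U * V) = mat_adjoint V * (mat_adjoint U * (U * V))"
    using u v by (simp add: mat_adjoint_mult[OF u(1) v(1)] assoc_mult_mat[of _ n n _ n _ n])
  also have "\<dots> = 1\<^sub>m n"
    using u v by (simp add: mult_mult_cancel_mat[of _ n _ _ n])
  finally show ?thesis using u v by (simp add: unitary_mats_def)
qed

lemma unitary_mats_adjoint:
  assumes "U \<in> unitary_mats n"
  shows "mat_adjoint U \<in> unitary_mats n"
  using unitary_matsD[OF assms] by (simp add: unitary_mats_def mat_adjoint_adjoint)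

lemma mat_adjoint_mat_diag:
  "mat_adjoint (mat_diag n d) = mat_diag n (\<lambda>i. cnj (d i))"
proof (rule eq_matI)
  fix i j assume "i < dim_row (mat_diag n (\<lambda>i. cnj (d i)))" "j < dim_col (mat_diag n (\<lambda>i. cnj (d i)))"
  then have ij: "i < n" "j < n" by (auto simp: mat_diag_def)
  then show "mat_adjoint (mat_diag n d) $$ (i, j) = mat_diag n (\<lambda>i. cnj (d i)) $$ (i, j)"
    unfolding mat_adjoint_index[OF mat_diag_dim ij] by (simp add: mat_diag_def)
qed (use mat_adjoint_carrier[OF mat_diag_dim, of n d] in \<open>auto simp: mat_diag_def\<close>)

section \<open>Diagonalization of unitary matrices\<close>

text \<open>Gram-Schmidt, applied to a basis completion of \<open>v\<close>, leaves the first vector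
  alone and only makes the others orthogonal to it; normalizing gives the columns of a unitary
  matrix, and \<open>c\<close> is the reciprocal of the norm of \<open>v\<close>.\<close>

lemma unitary_first_col:
  assumes v: "v \<in> carrier_vec n" and v0: "v \<noteq> 0\<^sub>v n"
  shows "\<exists>U \<in> unitary_mats n. \<exists>c. col U 0 = c \<cdot>\<^sub>v v"
proof -
  interpret cof_vec_space n "TYPE(complex)" .
  define b where "b = basis_completion v"
  define ws where "ws = gram_schmidt n b"
  note bc = basis_completion[OF v v0, folded b_def]
  have n: "n \<noteq> 0"
  proof
    assume "n = 0"
    then have "v = 0\<^sub>v n" using v by (intro eq_vecI) auto
    with v0 show False by simp
  qed
  then obtain vs where bv: "b = v # vs" using bc(6,7) by (cases b) auto
  note gs = gram_schmidt_result[OF bc(2,4,5) refl, folded ws_def]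
  have len: "length ws = n" using gs(4) bc(6) by simp
  have hdws: "hd ws = v" using gram_schmidt_hd[OF v, of vs] by (simp add: ws_def bv)
  then have ws0: "ws ! 0 = v" using len n by (cases ws) auto
  have wsc: "ws ! i \<in> carrier_vec n" if "i < n" for i using that gs(3) len by auto
  \<comment> \<open>Squared norms: the vectors \<open>ws\<close> are orthogonal but not normalized,
    so the columns of \<open>U\<close> are divided by \<open>sqrt (N i)\<close>.\<close>
  define N where "N i = (\<Sum>k<n. (cmod (ws ! i $ k))\<^sup>2)" for i
  have inner: "ws ! i \<bullet>c ws ! j = (\<Sum>k<n. ws ! i $ k * cnj (ws ! j $ k))" if "i < n" "j < n" for i j
    using wsc[OF that(1)] wsc[OF that(2)] by (auto simp: scalar_prod_def lessThan_atLeast0)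
  \<comment> \<open>The product \<open>\<bullet>c\<close> conjugates its second argument, whereas
    \<open>mat_adjoint U * U\<close> conjugates the first factor; hence the indices are
    exchanged.\<close>
  have orth: "(\<Sum>k<n. cnj (ws ! i $ k) * ws ! j $ k) = 0" if "i < n" "j < n" "i \<noteq> j" for i j
    using corthogonalD[OF gs(2), of j i] that inner[of j i] len by (simp add: mult.commute)
  have self: "(\<Sum>k<n. cnj (ws ! i $ k) * ws ! i $ k) = complex_of_real (N i)" for i
    unfolding N_def of_real_sum complex_norm_square by (simp add: mult.commute)
  have N0: "N i \<noteq> 0" if "i < n" for i
    using corthogonalD[OF gs(2), of i i] that inner[of i i] len self[of i] by (auto simp: mult.commute)
  have Npos: "N i > 0" if "i < n" for i
    using N0[OF that] by (simp add: N_def sum_nonneg order_less_le)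
  define U where "U = mat n n (\<lambda>(k, i). ws ! i $ k / complex_of_real (sqrt (N i)))"
  have U: "U \<in> carrier_mat n n" by (simp add: U_def)
  have "mat_adjoint U * U = 1\<^sub>m n"
  proof (rule eq_matI)
    fix i j assume "i < dim_row (1\<^sub>m n :: complex mat)" "j < dim_col (1\<^sub>m n :: complex mat)"
    then have ij: "i < n" "j < n" by auto
    have "(mat_adjoint U * U) $$ (i, j) = (\<Sum>k<n. mat_adjoint U $$ (i, k) * U $$ (k, j))"
      using ij U mat_adjoint_carrier[OF U] by (simp add: scalar_prod_def lessThan_atLeast0)
    also have "\<dots> = (\<Sum>k<n. cnj (ws ! i $ k) * ws ! j $ k / (complex_of_real (sqrt (N i)) * complex_of_real (sqrt (N j))))"
      using ij by (intro sum.cong) (auto simp: mat_adjoint_index[OF U], simp add: U_def)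
    also have "\<dots> = (\<Sum>k<n. cnj (ws ! i $ k) * ws ! j $ k) / (complex_of_real (sqrt (N i)) * complex_of_real (sqrt (N j)))"
      by (simp add: sum_divide_distrib)
    also have "\<dots> = (if i = j then 1 else 0)"
    proof (cases "i = j")
      case True
      then show ?thesis using Npos[OF ij(1)]
        by (simp add: self flip: of_real_mult)
    qed (use orth ij in simp)
    finally show "(mat_adjoint U * U) $$ (i, j) = 1\<^sub>m n $$ (i, j)" using ij by simp
  qed (use U mat_adjoint_carrier[OF U] in auto)
  then have "U \<in> unitary_mats n" using U by (simp add: unitary_mats_def)
  moreover have "col U 0 = (1 / complex_of_real (sqrt (N 0))) \<cdot>\<^sub>v v"
    using n v by (intro eq_vecI) (auto simp: U_def ws0)
  ultimately show ?thesis by blast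
qed

section \<open>Direct sums of a scalar and a square matrix\<close>

definition block_cons :: "complex \<Rightarrow> complex mat \<Rightarrow> complex mat" where
  "block_cons c M = four_block_mat (mat 1 1 (\<lambda>_. c)) (0\<^sub>m 1 (dim_col M)) (0\<^sub>m (dim_row M) 1) M"

lemma block_cons_carrier:
  "M \<in> carrier_mat n n \<Longrightarrow> block_cons c M \<in> carrier_mat (Suc n) (Suc n)"
  by (auto simp: block_cons_def)

lemma block_cons_index:
  assumes "M \<in> carrier_mat n n" "i < Suc n" "j < Suc n"
  shows "block_cons c M $$ (i, j) =
    (if i = 0 then if j = 0 then c else 0 else if j = 0 then 0 else M $$ (i - 1, j - 1))"
  using assms by (auto simp: block_cons_def)

lemma block_cons_mult:
  assumes "M \<in> carrier_mat n n" "N \<in> carrier_mat n n"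
  shows "block_cons a M * block_cons b N = block_cons (a * b) (M * N)"
proof -
  have "mat 1 1 (\<lambda>_. a) * mat 1 1 (\<lambda>_. b) = mat 1 1 (\<lambda>_. a * b)"
    by (intro eq_matI) (auto simp: scalar_prod_def)
  then show ?thesis
    using assms
    by (auto simp: block_cons_def mult_four_block_mat[of _ 1 1 _ n _ n _ _ 1 _ n])
qed

lemma block_cons_adjoint:
  assumes "M \<in> carrier_mat n n"
  shows "mat_adjoint (block_cons c M) = block_cons (cnj c) (mat_adjoint M)"
proof (rule eq_matI)
  note c = block_cons_carrier[OF assms] mat_adjoint_carrier[OF block_cons_carrier[OF assms]]
    block_cons_carrier[OF mat_adjoint_carrier[OF assms]] mat_adjoint_carrier[OF assms]
  show "dim_row (mat_adjoint (block_cons c M)) = dim_row (block_cons (cnj c) (mat_adjoint M))"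
    "dim_col (mat_adjoint (block_cons c M)) = dim_col (block_cons (cnj c) (mat_adjoint M))"
    using c(2)[of c] c(3)[of "cnj c"] by auto
  fix i j
  assume "i < dim_row (block_cons (cnj c) (mat_adjoint M))" "j < dim_col (block_cons (cnj c) (mat_adjoint M))"
  then have ij: "i < Suc n" "j < Suc n" using c(3)[of "cnj c"] by auto
  then show "mat_adjoint (block_cons c M) $$ (i, j) = block_cons (cnj c) (mat_adjoint M) $$ (i, j)"
    by (simp add: mat_adjoint_index[OF c(1)] block_cons_index[OF assms] block_cons_index[OF c(4)]
        mat_adjoint_index[OF assms])
qed

lemma block_cons_mat_diag:
  "block_cons (d 0) (mat_diag n (\<lambda>i. d (Suc i))) = mat_diag (Suc n) d"
proof (rule eq_matI)
  note c = block_cons_carrier[OF mat_diag_dim[of n "\<lambda>i. d (Suc i)"], of "d 0"]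
  show "dim_row (block_cons (d 0) (mat_diag n (\<lambda>i. d (Suc i)))) = dim_row (mat_diag (Suc n) d)"
    "dim_col (block_cons (d 0) (mat_diag n (\<lambda>i. d (Suc i)))) = dim_col (mat_diag (Suc n) d)"
    using c by (auto simp: mat_diag_def)
  fix i j assume "i < dim_row (mat_diag (Suc n) d)" "j < dim_col (mat_diag (Suc n) d)"
  then have ij: "i < Suc n" "j < Suc n" by (auto simp: mat_diag_def)
  then show "block_cons (d 0) (mat_diag n (\<lambda>i. d (Suc i))) $$ (i, j) = mat_diag (Suc n) d $$ (i, j)"
    by (cases i; cases j) (simp_all add: block_cons_index[OF mat_diag_dim], simp_all add: mat_diag_def)
qed

lemma block_cons_one: "block_cons 1 (1\<^sub>m n) = 1\<^sub>m (Suc n)"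
  using block_cons_mat_diag[of "\<lambda>_. 1" n] by simp

lemma block_cons_inject:
  assumes "M \<in> carrier_mat n n" "N \<in> carrier_mat n n" "block_cons a M = block_cons b N"
  shows "a = b \<and> M = N"
proof -
  have idx: "block_cons a M $$ (i, j) = block_cons b N $$ (i, j)" for i j using assms(3) by simp
  have "a = b" using idx[of 0 0] by (simp add: block_cons_index[OF assms(1)] block_cons_index[OF assms(2)])
  moreover have "M = N"
  proof (rule eq_matI)
    fix i j assume "i < dim_row N" "j < dim_col N"
    then show "M $$ (i, j) = N $$ (i, j)"
      using assms(1,2) idx[of "Suc i" "Suc j"]
      by (simp add: block_cons_index[OF assms(1)] block_cons_index[OF assms(2)])
  qed (use assms in auto)
  ultimately show ?thesis by simp
qed

text \<open>Adjoints and products of direct sums are formed blockwise, and the identity is itself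
  the direct sum of \<open>1\<close> and a smaller identity, so the two blocks can be compared
  separately.\<close>

lemma unitary_block_cons_iff:
  assumes "M \<in> carrier_mat n n"
  shows "block_cons c M \<in> unitary_mats (Suc n) \<longleftrightarrow> cnj c * c = 1 \<and> M \<in> unitary_mats n"
proof -
  have MM: "mat_adjoint M * M \<in> carrier_mat n n"
    using assms mat_adjoint_carrier[OF assms] by simp
  have "mat_adjoint (block_cons c M) * block_cons c M = block_cons (cnj c * c) (mat_adjoint M * M)"
    by (simp add: block_cons_adjoint[OF assms] block_cons_mult[OF mat_adjoint_carrier[OF assms] assms])
  then have "block_cons c M \<in> unitary_mats (Suc n) \<longleftrightarrow>
      block_cons (cnj c * c) (mat_adjoint M * M) = block_cons 1 (1\<^sub>m n)"
    by (simp add: unitary_mats_def block_cons_carrier[OF assms] block_cons_one)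
  also have "\<dots> \<longleftrightarrow> cnj c * c = 1 \<and> mat_adjoint M * M = 1\<^sub>m n"
    using block_cons_inject[OF MM one_carrier_mat] by metis
  finally show ?thesis by (simp add: unitary_mats_def assms)
qed

text \<open>The columns are orthonormal and the first one is concentrated in its top entry, which is
  therefore nonzero. Orthogonality to it forces every other column to vanish in the top row.\<close>

lemma unitary_block_of_first_col:
  assumes M: "M \<in> unitary_mats (Suc n)" and col: "\<And>i. 0 < i \<Longrightarrow> i < Suc n \<Longrightarrow> M $$ (i, 0) = 0"
  shows "\<exists>e N. N \<in> carrier_mat n n \<and> M = block_cons e N"
proof -
  note m = unitary_matsD[OF M]
  let ?e = "M $$ (0, 0)"
  have inner: "(\<Sum>k<Suc n. cnj (M $$ (k, i)) * M $$ (k, j)) = (if i = j then 1 else 0)"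
    if "i < Suc n" "j < Suc n" for i j
  proof -
    have "(mat_adjoint M * M) $$ (i, j) = (\<Sum>k<Suc n. mat_adjoint M $$ (i, k) * M $$ (k, j))"
      using m(1,2) that by (simp add: scalar_prod_def lessThan_atLeast0 del: sum.lessThan_Suc sum.op_ivl_Suc)
    also have "\<dots> = (\<Sum>k<Suc n. cnj (M $$ (k, i)) * M $$ (k, j))"
      using that by (intro sum.cong) (auto simp: mat_adjoint_index[OF m(1)])
    finally show ?thesis using that by (simp add: m(3))
  qed
  \<comment> \<open>In the inner product with the first column only the term \<open>k = 0\<close>
    survives.\<close>
  have first: "cnj ?e * M $$ (0, j) = (if 0 = j then 1 else 0)" if "j < Suc n" for j
  proof -
    have "(\<Sum>k<Suc n. cnj (M $$ (k, 0)) * M $$ (k, j)) = cnj ?e * M $$ (0, j)"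
      by (simp add: sum.lessThan_Suc_shift col del: sum.lessThan_Suc)
    with inner[of 0 j] that show ?thesis by simp
  qed
  from first[of 0] have "?e \<noteq> 0" by auto
  with first have row: "M $$ (0, j) = 0" if "0 < j" "j < Suc n" for j using that by force
  define N where "N = mat n n (\<lambda>(i, j). M $$ (Suc i, Suc j))"
  have N: "N \<in> carrier_mat n n" by (simp add: N_def)
  have "M = block_cons ?e N"
    using m(1) block_cons_carrier[OF N, of ?e]
    by (intro eq_matI) (auto simp: block_cons_index[OF N] row col, simp add: N_def)
  with N show ?thesis by blast
qed

text \<open>Induction on the dimension: an eigenvector is rotated to the first coordinate axis,
  unitarity then splits off a scalar block, and the remaining block is diagonalized by the induction
  hypothesis.\<close>

theorem unitary_diagonalizable:
  assumes "A \<in> unitary_mats n"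
  shows "\<exists>U \<in> unitary_mats n. \<exists>d. mat_adjoint U * A * U = mat_diag n d"
  using assms
proof (induction n arbitrary: A)
  case 0
  then show ?case
    by (intro bexI[of _ A] exI[of _ "\<lambda>_. 0"] eq_matI) (auto simp: unitary_mats_def mat_diag_def mat_adjoint_def)
next
  case (Suc n)
  note a = unitary_matsD[OF Suc.prems]
  obtain as where "char_poly A = (\<Prod>a\<leftarrow>as. [:- a, 1:])" "length as = Suc n"
    using char_poly_factorized[OF a(1)] by blast
  then obtain e where "poly (char_poly A) e = 0"
    by (cases as) auto
  then have "eigenvalue A e" using eigenvalue_root_char_poly[OF a(1)] by simp
  then obtain v where v: "v \<in> carrier_vec (Suc n)" "v \<noteq> 0\<^sub>v (Suc n)" "A *\<^sub>v v = e \<cdot>\<^sub>v v"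
    using a(1) by (auto simp: eigenvalue_def eigenvector_def)
  obtain U c where U: "U \<in> unitary_mats (Suc n)" and c: "col U 0 = c \<cdot>\<^sub>v v"
    using unitary_first_col[OF v(1,2)] by blast
  note u = unitary_matsD[OF U]
  define M where "M = mat_adjoint U * A * U"
  have M: "M \<in> unitary_mats (Suc n)"
    unfolding M_def by (intro unitary_mats_mult unitary_mats_adjoint U Suc.prems)
  have cU: "col U 0 \<in> carrier_vec (Suc n)" using v(1) by (simp add: c)
  \<comment> \<open>\<open>U\<close> sends the first unit vector to an eigenvector of
    \<open>A\<close>, so \<open>M\<close> maps that unit vector to a multiple of itself.\<close>
  have "col M 0 = mat_adjoint U *\<^sub>v (A *\<^sub>v col U 0)"
    using a u cU unfolding M_def
    by (subst col_mult2[of _ "Suc n" "Suc n" _ "Suc n"]) (auto intro: assoc_mult_mat_vec)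
  also have "A *\<^sub>v col U 0 = e \<cdot>\<^sub>v col U 0"
    using v(1,3) a(1) by (simp add: c mult_mat_vec[of _ "Suc n" "Suc n"] smult_smult_assoc mult.commute)
  also have "mat_adjoint U *\<^sub>v (e \<cdot>\<^sub>v col U 0) = e \<cdot>\<^sub>v (mat_adjoint U *\<^sub>v col U 0)"
    using u cU by (simp add: mult_mat_vec[of _ "Suc n" "Suc n"])
  also have "mat_adjoint U *\<^sub>v col U 0 = unit_vec (Suc n) 0"
    using col_mult2[OF u(2,1), of 0] by (simp add: u(3))
  finally have colM: "col M 0 = e \<cdot>\<^sub>v unit_vec (Suc n) 0" .
  have "M $$ (i, 0) = 0" if "0 < i" "i < Suc n" for i
  proof -
    have "M $$ (i, 0) = col M 0 $ i" using that unitary_matsD(1)[OF M] by simp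
    then show ?thesis using that by (simp add: colM)
  qed
  from unitary_block_of_first_col[OF M this] obtain e' N
    where N: "N \<in> carrier_mat n n" and MN: "M = block_cons e' N" by blast
  have "N \<in> unitary_mats n" using M by (simp add: MN unitary_block_cons_iff[OF N])
  from Suc.IH[OF this] obtain V d where V: "V \<in> unitary_mats n"
    and d: "mat_adjoint V * N * V = mat_diag n d" by blast
  note v = unitary_matsD[OF V]
  \<comment> \<open>The smaller base change is extended by the identity on the eigenvector already
    found.\<close>
  define W where "W = block_cons 1 V"
  have W: "W \<in> unitary_mats (Suc n)" by (simp add: W_def unitary_block_cons_iff[OF v(1)] V)
  note w = unitary_matsD[OF W]
  have "mat_adjoint (U * W) * A * (U * W) = mat_adjoint W * M * W"
    using u w a by (simp add: M_def mat_adjoint_mult[OF u(1) w(1)] assoc_mult_mat[of _ "Suc n" "Suc n" _ "Suc n" _ "Suc n"])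
  also have "\<dots> = block_cons e' (mat_adjoint V * N * V)"
    using v N by (simp add: W_def MN block_cons_adjoint[OF v(1)] block_cons_mult[of _ n])
  \<comment> \<open>\<open>case_nat e' d\<close> puts the split-off eigenvalue in front of those of
    the block.\<close>
  also have "\<dots> = mat_diag (Suc n) (case_nat e' d)"
    using block_cons_mat_diag[of "case_nat e' d" n] by (simp add: d)
  finally show ?case using unitary_mats_mult[OF U W] by blast
qed

section \<open>Multiplicities\<close>

text \<open>Orders add over a product of nonzero polynomials, and each linear factor contributes one
  exactly at its own root.\<close>

lemma order_char_poly_diag:
  "Polynomial.order x (\<Prod>a\<leftarrow>map d [0..<n]. [:- a, 1:]) = card {i. i < n \<and> d i = (x :: complex)}"
proof (induction n)
  case (Suc n)
  let ?p = "\<Prod>a\<leftarrow>map d [0..<n]. [:- a, 1:]"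
  have "?p \<noteq> 0" unfolding prod_list_zero_iff by auto
  then have "?p * [:- d n, 1:] \<noteq> 0" by (simp del: mult_pCons_right)
  then have "Polynomial.order x (?p * [:- d n, 1:])
      = Polynomial.order x ?p + Polynomial.order x [:- d n, 1:]" by (rule order_mult)
  moreover have "(\<Prod>a\<leftarrow>map d [0..<Suc n]. [:- a, 1:]) = ?p * [:- d n, 1:]"
    by (simp del: mult_pCons_right)
  moreover have "Polynomial.order x [:- d n, 1:] = (if d n = x then 1 else 0)"
    using order_power_n_n[of x 1] by (auto intro!: order_0I)
  moreover have "{i. i < Suc n \<and> d i = x} = (if d n = x then insert n else id) {i. i < n \<and> d i = x}"
    by (auto simp: less_Suc_eq)
  ultimately show ?case using Suc.IH by simp
qed simp

section \<open>Computing in a fixed eigenbasis\<close>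

locale unitary_diag =
  fixes n :: nat and A U :: "complex mat" and d :: "nat \<Rightarrow> complex"
  assumes A: "A \<in> unitary_mats n" and U: "U \<in> unitary_mats n"
    and diag: "mat_adjoint U * A * U = mat_diag n d"
begin

lemmas u = unitary_matsD[OF U]

lemmas a = unitary_matsD[OF A]

lemmas assoc = assoc_mult_mat[of _ n n _ n _ n]

text \<open>Carries a matrix written in the eigenbasis back to standard coordinates. Since this
  respects sums, products, adjoints and determinants, identities about \<open>A\<close> can be
  checked on diagonal and permutation matrices.\<close>

definition cj :: "complex mat \<Rightarrow> complex mat" where
  "cj X = U * X * mat_adjoint U"

lemma cj_carrier [simp]: "X \<in> carrier_mat n n \<Longrightarrow> cj X \<in> carrier_mat n n"
  using u by (simp add: cj_def)

lemma cj_mult: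
  assumes "X \<in> carrier_mat n n" "Y \<in> carrier_mat n n"
  shows "cj X * cj Y = cj (X * Y)"
  using u assms by (simp add: cj_def assoc mult_mult_cancel_mat[of _ n _ _ n])

lemma cj_one: "cj (1\<^sub>m n) = 1\<^sub>m n"
  using u by (simp add: cj_def)

lemma cj_add:
  assumes "X \<in> carrier_mat n n" "Y \<in> carrier_mat n n"
  shows "cj (X + Y) = cj X + cj Y"
  using u assms by (simp add: cj_def mult_add_distrib_mat[of _ n n _ n] add_mult_distrib_mat[of _ n n _ _ n])

lemma cj_uminus:
  assumes "X \<in> carrier_mat n n"
  shows "cj (- X) = - cj X"
  using u assms by (simp add: cj_def)

lemma cj_adjoint:
  assumes "X \<in> carrier_mat n n"
  shows "mat_adjoint (cj X) = cj (mat_adjoint X)"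
  using u assms mat_adjoint_carrier[OF assms]
  by (simp add: cj_def mat_adjoint_mult[of _ n] mat_adjoint_adjoint[of _ n] assoc)

lemma det_cj:
  assumes "X \<in> carrier_mat n n"
  shows "det (cj X) = det X"
proof -
  have "det U * det (mat_adjoint U) = 1" using det_mult[OF u(1,2)] u(4) by simp
  then show ?thesis using u assms by (simp add: cj_def det_mult[of _ n] mult.commute mult.left_commute)
qed

lemma A_eq: "A = cj (mat_diag n d)"
  using u a by (simp add: cj_def assoc mult_mult_cancel_mat[of _ n _ _ n] flip: diag)

lemma A_adjoint_eq: "mat_adjoint A = cj (mat_diag n (\<lambda>i. cnj (d i)))"
  by (simp add: A_eq cj_adjoint mat_adjoint_mat_diag)

lemma order_char_poly_cj:
  "Polynomial.order x (char_poly (cj (mat_diag n f))) = card {i. i < n \<and> f i = x}"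
proof -
  have "similar_mat (cj (mat_diag n f)) (mat_diag n f)"
    unfolding similar_mat_def
    by (rule exI[of _ U], rule exI[of _ "mat_adjoint U"], rule similar_mat_witI[of _ _ n])
      (use u in \<open>simp_all add: cj_def mult_carrier_mat[of _ n n]\<close>)
  then have "char_poly (cj (mat_diag n f)) = char_poly (mat_diag n f)" by (rule char_poly_similar)
  also have "\<dots> = (\<Prod>a\<leftarrow>diag_mat (mat_diag n f). [:- a, 1:])"
    by (rule char_poly_upper_triangular[OF mat_diag_dim]) (auto simp: mat_diag_def)
  also have "diag_mat (mat_diag n f) = map f [0..<n]"
    by (auto simp: diag_mat_def mat_diag_def)
  finally show ?thesis by (simp only: order_char_poly_diag)
qed

lemma order_char_poly: "Polynomial.order x (char_poly A) = card {i. i < n \<and> d i = x}"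
  using order_char_poly_cj[of x d] by (simp flip: A_eq)

lemma order_char_poly_adjoint:
  "Polynomial.order x (char_poly (mat_adjoint A)) = card {i. i < n \<and> cnj (d i) = x}"
  using order_char_poly_cj[of x "\<lambda>i. cnj (d i)"] by (simp flip: A_adjoint_eq)

lemma root_char_poly: "poly (char_poly A) x = 0 \<longleftrightarrow> (\<exists>i<n. d i = x)"
proof -
  have "char_poly A \<noteq> 0" using degree_monic_char_poly[OF a(1)] by auto
  then have "poly (char_poly A) x = 0 \<longleftrightarrow> Polynomial.order x (char_poly A) \<noteq> 0"
    by (simp add: order_root)
  then show ?thesis by (auto simp: order_char_poly)
qed

text \<open>Eigenvalues have modulus one: in the eigenbasis, \<open>mat_adjoint A * A\<close> is
  diagonal, and its entries can be compared with those of the identity.\<close>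

lemma cnj_d: "i < n \<Longrightarrow> cnj (d i) * d i = 1"
proof -
  assume i: "i < n"
  have "cj (mat_diag n (\<lambda>i. cnj (d i) * d i)) = 1\<^sub>m n"
    using a(3) cj_mult[of "mat_diag n (\<lambda>i. cnj (d i))" "mat_diag n d"]
    by (simp flip: A_eq A_adjoint_eq)
  then have "mat_adjoint U * cj (mat_diag n (\<lambda>i. cnj (d i) * d i)) * U = 1\<^sub>m n"
    using u by simp
  moreover have "mat_adjoint U * cj X * U = X" if "X \<in> carrier_mat n n" for X
    using u that by (simp add: cj_def assoc mult_mult_cancel_mat[of _ n _ _ n])
  ultimately have "mat_diag n (\<lambda>i. cnj (d i) * d i) = 1\<^sub>m n" by simp
  then have "mat_diag n (\<lambda>i. cnj (d i) * d i) $$ (i, i) = 1\<^sub>m n $$ (i, i)" by simp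
  with i show ?thesis by (simp add: mat_diag_def)
qed

lemma inverse_d: "i < n \<Longrightarrow> inverse (d i) = cnj (d i)"
  using cnj_d[of i] by (metis inverse_unique mult.commute)

text \<open>The adjoint has the conjugate eigenvalues with the same multiplicities, and on the unit
  circle conjugation is inversion; similar matrices have equal characteristic polynomials.\<close>

lemma self_dual_if_similar_adjoint:
  assumes "similar_mat (mat_adjoint A) A"
  shows "self_dual (char_poly A)"
  unfolding self_dual_def
proof (intro allI impI)
  fix x assume x: "poly (char_poly A) x = 0 \<and> x \<noteq> 1 \<and> x \<noteq> -1"
  then obtain i where i: "i < n" "d i = x" using root_char_poly by blast
  then have inv: "inverse x = cnj x" using inverse_d by blast
  \<comment> \<open>The order is counted on the adjoint, where \<open>cnj (d i) = cnj x\<close> is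
    the same condition as \<open>d i = x\<close>.\<close>
  have "Polynomial.order (inverse x) (char_poly A) = card {i. i < n \<and> cnj (d i) = cnj x}"
    using char_poly_similar[OF assms] order_char_poly_adjoint[of "inverse x"] by (simp add: inv)
  also have "\<dots> = Polynomial.order x (char_poly A)" by (simp add: order_char_poly)
  finally have ord: "Polynomial.order (inverse x) (char_poly A) = Polynomial.order x (char_poly A)" .
  have "char_poly A \<noteq> 0" using degree_monic_char_poly[OF a(1)] by auto
  with x ord show "poly (char_poly A) (inverse x) = 0 \<and>
      Polynomial.order (inverse x) (char_poly A) = Polynomial.order x (char_poly A)"
    by (simp add: order_root)
qed

end

section \<open>A reversing involution\<close>

lemma conjugating_involution_exists:
  fixes d :: "nat \<Rightarrow> complex"
  assumes card: "\<And>x. card {i. i < n \<and> d i = x} = card {i. i < n \<and> d i = cnj x}"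
  obtains \<sigma> where "\<And>i. i < n \<Longrightarrow> \<sigma> i < n" "\<And>i. i < n \<Longrightarrow> \<sigma> (\<sigma> i) = i"
    "\<And>i. i < n \<Longrightarrow> d (\<sigma> i) = cnj (d i)" "\<And>i. i < n \<Longrightarrow> Im (d i) = 0 \<Longrightarrow> \<sigma> i = i"
proof -
  define F where "F x = {i. i < n \<and> d i = x}" for x
  have "\<exists>f. bij_betw f (F x) (F (cnj x))" for x
    by (rule finite_same_card_bij) (use card in \<open>auto simp: F_def\<close>)
  then obtain f where f: "bij_betw (f x) (F x) (F (cnj x))" for x by metis
  \<comment> \<open>\<open>f (cnj x)\<close> maps \<open>F (cnj x)\<close> to \<open>F x\<close>, so
    its inverse goes in the direction required at \<open>x\<close>.\<close>
  define g where "g x = inv_into (F (cnj x)) (f (cnj x))" for x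
  have g: "bij_betw (g x) (F x) (F (cnj x))" for x
    using bij_betw_inv_into[OF f[of "cnj x"]] by (simp add: g_def)
  define \<sigma> where "\<sigma> i = (if Im (d i) > 0 then f (d i) i else if Im (d i) < 0 then g (d i) i else i)" for i
  have fF: "f (d i) i \<in> F (cnj (d i))" and gF: "g (d i) i \<in> F (cnj (d i))" if "i < n" for i
    using that bij_betwE[OF f[of "d i"]] bij_betwE[OF g[of "d i"]] by (auto simp: F_def)
  have gf: "g (cnj (d i)) (f (d i) i) = i" and fg: "f (cnj (d i)) (g (d i) i) = i" if "i < n" for i
    using that bij_betw_inv_into_left[OF f[of "d i"], of i]
      bij_betw_inv_into_right[OF f[of "cnj (d i)"], of i] by (auto simp: g_def F_def)
  show thesis
  proof (rule that[of \<sigma>])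
    fix i assume i: "i < n"
    show "\<sigma> i < n" using fF[OF i] gF[OF i] i by (auto simp: \<sigma>_def F_def)
    show *: "d (\<sigma> i) = cnj (d i)"
      using fF[OF i] gF[OF i] i by (auto simp: \<sigma>_def F_def complex_eq_iff)
    \<comment> \<open>The sign change makes the second application of \<sigma> use the other of the
      two mutually inverse maps.\<close>
    then have "Im (d (\<sigma> i)) = - Im (d i)" by simp
    then show "\<sigma> (\<sigma> i) = i"
      using * gf[OF i] fg[OF i] by (auto simp: \<sigma>_def)
    show "\<sigma> i = i" if "Im (d i) = 0" using that by (simp add: \<sigma>_def)
  qed
qed

section \<open>Permutation matrices of involutions\<close>

definition involution_mat :: "nat \<Rightarrow> (nat \<Rightarrow> nat) \<Rightarrow> complex mat" where
  "involution_mat n \<sigma> = mat n n (\<lambda>(i, j). if i = \<sigma> j then 1 else 0)"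

lemma involution_mat_carrier [simp]: "involution_mat n \<sigma> \<in> carrier_mat n n"
  by (simp add: involution_mat_def)

text \<open>Since \<sigma> is its own inverse, \<open>i = \<sigma> j\<close> is symmetric in
  \<open>i\<close> and \<open>j\<close>; the real permutation matrix is thus self-adjoint as well as
  its own inverse, and moving it past a diagonal matrix relabels the entries.\<close>

lemma involution_mat_props:
  assumes \<sigma>: "\<And>i. i < n \<Longrightarrow> \<sigma> i < n" "\<And>i. i < n \<Longrightarrow> \<sigma> (\<sigma> i) = i"
  shows "involution_mat n \<sigma> * mat_diag n s = mat_diag n (\<lambda>i. s (\<sigma> i)) * involution_mat n \<sigma>"
    "involution_mat n \<sigma> * involution_mat n \<sigma> = 1\<^sub>m n"
    "mat_adjoint (involution_mat n \<sigma>) = involution_mat n \<sigma>"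
proof -
  have sym: "i = \<sigma> j \<longleftrightarrow> j = \<sigma> i" if "i < n" "j < n" for i j using \<sigma> that by metis
  show "involution_mat n \<sigma> * mat_diag n s = mat_diag n (\<lambda>i. s (\<sigma> i)) * involution_mat n \<sigma>"
    unfolding mat_diag_mult_left[OF involution_mat_carrier] mat_diag_mult_right[OF involution_mat_carrier]
    by (rule eq_matI) (use \<sigma> in \<open>auto simp: involution_mat_def\<close>)
  show "involution_mat n \<sigma> * involution_mat n \<sigma> = 1\<^sub>m n"
  proof (rule eq_matI)
    fix i j assume "i < dim_row (1\<^sub>m n :: complex mat)" "j < dim_col (1\<^sub>m n :: complex mat)"
    then have ij: "i < n" "j < n" by auto
    then have "(involution_mat n \<sigma> * involution_mat n \<sigma>) $$ (i, j)
        = (\<Sum>k<n. (if i = \<sigma> k then 1 else 0) * (if k = \<sigma> j then 1 else 0))"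
      by (simp add: involution_mat_def scalar_prod_def lessThan_atLeast0)
    also have "\<dots> = (\<Sum>k<n. if k = \<sigma> j then (if i = \<sigma> k then 1 else 0) else 0)"
      by (intro sum.cong) auto
    also have "\<dots> = 1\<^sub>m n $$ (i, j)" using ij \<sigma> by simp
    finally show "(involution_mat n \<sigma> * involution_mat n \<sigma>) $$ (i, j) = 1\<^sub>m n $$ (i, j)" .
  qed (simp_all add: involution_mat_def)
  show "mat_adjoint (involution_mat n \<sigma>) = involution_mat n \<sigma>"
  proof (rule eq_matI)
    fix i j assume "i < dim_row (involution_mat n \<sigma>)" "j < dim_col (involution_mat n \<sigma>)"
    then have ij: "i < n" "j < n" by (auto simp: involution_mat_def)
    show "mat_adjoint (involution_mat n \<sigma>) $$ (i, j) = involution_mat n \<sigma> $$ (i, j)"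
      unfolding mat_adjoint_index[OF involution_mat_carrier ij]
      using ij sym[OF ij] by (simp add: involution_mat_def)
  qed (use mat_adjoint_carrier[OF involution_mat_carrier, of n \<sigma>] in \<open>auto simp: involution_mat_def\<close>)
qed

lemma det_mat_diag: "det (mat_diag n s) = (\<Prod>i<n. s i :: complex)"
proof -
  have "det (mat_diag n s) = prod_list (diag_mat (mat_diag n s))"
    by (rule det_upper_triangular[of _ n]) (auto simp: mat_diag_def)
  also have "diag_mat (mat_diag n s) = map s [0..<n]"
    by (auto simp: diag_mat_def mat_diag_def)
  finally show ?thesis by (simp add: prod.list_conv_set_nth lessThan_atLeast0)
qed

lemma mat_diag_cong: "(\<And>i. i < n \<Longrightarrow> f i = g i) \<Longrightarrow> mat_diag n f = mat_diag n g"
  by (rule eq_matI) (auto simp: mat_diag_def)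

context unitary_diag
begin

text \<open>Provides the pairing hypothesis. Self-duality covers eigenvalues other than 1 and -1,
  these two equal their own conjugates, and if neither \<open>x\<close> nor \<open>cnj x\<close> is
  an eigenvalue both sets are empty.\<close>

lemma card_eigenvalue_cnj:
  assumes "self_dual (char_poly A)"
  shows "card {i. i < n \<and> d i = x} = card {i. i < n \<and> d i = cnj x}"
proof -
  have eq: "card {i. i < n \<and> d i = y} = card {i. i < n \<and> d i = cnj y}" if i: "i < n" "d i = y" for i y
  proof (cases "y = 1 \<or> y = -1")
    case False
    then have "Polynomial.order (inverse y) (char_poly A) = Polynomial.order y (char_poly A)"
      using assms i root_char_poly[of y] unfolding self_dual_def by blast
    then show ?thesis using inverse_d[OF i(1)] i(2) by (simp add: order_char_poly)
  qed auto
  show ?thesis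
  proof (cases "\<exists>i<n. d i = x \<or> d i = cnj x")
    case True
    then show ?thesis using eq[of _ x] eq[of _ "cnj x"] by auto
  next
    case False
    then have "{i. i < n \<and> d i = x} = {}" "{i. i < n \<and> d i = cnj x} = {}" by auto
    then show ?thesis by (simp only:)
  qed
qed

text \<open>\<open>E\<close> is the projection to the fixed space of \<open>A\<close>, and \<open>K\<close> inverts \<open>1 - A\<close> on its complement.\<close>

lemma reversing_involution_exists:
  assumes dual: "self_dual (char_poly A)" and i0: "i0 < n" "d i0 = -1"
  shows "\<exists>B K E. B \<in> special_unitary n \<and> K \<in> carrier_mat n n \<and> E \<in> carrier_mat n n \<and>
    B * B = 1\<^sub>m n \<and> B * A * (B * A) = 1\<^sub>m n \<and> A * K + 1\<^sub>m n = K + E \<and> A * E = E \<and> B * E = - E"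
proof -
  obtain \<sigma> where \<sigma>: "\<And>i. i < n \<Longrightarrow> \<sigma> i < n" "\<And>i. i < n \<Longrightarrow> \<sigma> (\<sigma> i) = i"
    and d\<sigma>: "\<And>i. i < n \<Longrightarrow> d (\<sigma> i) = cnj (d i)" and fix\<sigma>: "\<And>i. i < n \<Longrightarrow> Im (d i) = 0 \<Longrightarrow> \<sigma> i = i"
    using conjugating_involution_exists[OF card_eigenvalue_cnj[OF dual]] by blast
  \<comment> \<open>In the eigenbasis, \<open>Q\<close> swaps eigenvectors with conjugate
    eigenvalues.\<close>
  define Q where "Q = involution_mat n \<sigma>"
  have q: "Q * mat_diag n f = mat_diag n (\<lambda>i. f (\<sigma> i)) * Q"
    "Q * Q = 1\<^sub>m n" "mat_adjoint Q = Q" for f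
    unfolding Q_def by (rule involution_mat_props; use \<sigma> in blast)+
  have Q [simp]: "Q \<in> carrier_mat n n" by (simp add: Q_def)
  note [simp] = mult_carrier_mat[of _ n n _ n]
  \<comment> \<open>The sign -1 on the fixed space of \<open>A\<close> is what yields
    \<open>B * E = - E\<close>.\<close>
  define s0 :: "nat \<Rightarrow> complex" where "s0 i = (if d i = 1 then -1 else 1)" for i
  \<comment> \<open>The determinant that the signs \<open>s0\<close> alone would give. It is 1 or
    -1, so using it as an extra sign at \<open>i0\<close> makes the determinant
    \<open>t * t = 1\<close>.\<close>
  define t where "t = det Q * (\<Prod>i<n. s0 i)"
  define s where "s i = s0 i * (if i = i0 then t else 1)" for i
  have tt: "t * t = 1"
  proof -
    have "det Q * det Q = 1" using det_mult[OF Q Q] q(2) by simp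
    moreover have "(\<Prod>i<n. s0 i) * (\<Prod>i<n. s0 i) = 1"
      unfolding prod.distrib[symmetric] by (rule prod.neutral) (simp add: s0_def)
    moreover have "t * t = (det Q * det Q) * ((\<Prod>i<n. s0 i) * (\<Prod>i<n. s0 i))"
      unfolding t_def by (simp only: mult_ac)
    ultimately show ?thesis by simp
  qed
  then have t: "t = 1 \<or> t = -1" by (simp add: square_eq_1_iff)
  have ss: "s i * s i = 1" and cnjs: "cnj (s i) = s i" for i
    using t by (auto simp: s_def s0_def)
  \<comment> \<open>Signs other than 1 occur only at the eigenvalues 1 and -1, whose indices
    \<sigma> fixes. Hence the sign matrix commutes with \<open>Q\<close>.\<close>
  have s\<sigma>: "s (\<sigma> i) = s i" if "i < n" for i
  proof (cases "Im (d i) = 0")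
    case False
    then have "d i \<noteq> 1" "d i \<noteq> -1" "d (\<sigma> i) \<noteq> 1" "d (\<sigma> i) \<noteq> -1"
      using d\<sigma>[OF that] by (auto simp: complex_eq_iff)
    then show ?thesis using i0 by (auto simp: s_def s0_def)
  qed (simp add: fix\<sigma> that)
  define P where "P = Q * mat_diag n s"
  have P [simp]: "P \<in> carrier_mat n n" unfolding P_def by (rule mult_carrier_mat[OF Q mat_diag_dim])
  have Psym: "P = mat_diag n s * Q"
  proof -
    have "mat_diag n (\<lambda>i. s (\<sigma> i)) = mat_diag n s" by (rule mat_diag_cong) (rule s\<sigma>)
    then show ?thesis using q(1)[of s] by (simp add: P_def)
  qed
  \<comment> \<open>One sign matrix is moved to each end, so that every sign meets itself and
    cancels.\<close>
  have conjP: "P * mat_diag n f * P = mat_diag n (\<lambda>i. f (\<sigma> i))" for f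
  proof -
    have "P * mat_diag n f * P = mat_diag n s * (Q * mat_diag n f * Q) * mat_diag n s"
      by (subst Psym, subst P_def) (simp add: assoc)
    also have "Q * mat_diag n f * Q = mat_diag n (\<lambda>i. f (\<sigma> i))"
      unfolding q(1)[of f] by (simp add: q(2) assoc right_mult_one_mat[OF mat_diag_dim])
    moreover have "s i * (f (\<sigma> i) * s i) = f (\<sigma> i)" for i
    proof -
      have "s i * (f (\<sigma> i) * s i) = s i * s i * f (\<sigma> i)" by (simp only: mult_ac)
      then show ?thesis by (simp add: ss)
    qed
    ultimately show ?thesis by (simp add: mult.assoc)
  qed
  have PP: "P * P = 1\<^sub>m n" using conjP[of "\<lambda>_. 1"] by (simp add: right_mult_one_mat[OF P])
  have "mat_adjoint P = P"
    unfolding P_def mat_adjoint_mult[OF Q mat_diag_dim] mat_adjoint_mat_diag q(3)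
    using Psym by (simp add: cnjs P_def)
  moreover have "det P = 1"
  proof -
    have "det P = det Q * (\<Prod>i<n. s i)" by (simp add: P_def det_mult[of _ n] det_mat_diag)
    also have "(\<Prod>i<n. s i) = (\<Prod>i<n. s0 i) * t" using i0 by (simp add: s_def prod.distrib)
    also have "det Q * ((\<Prod>i<n. s0 i) * t) = t * t" by (simp only: t_def mult.assoc)
    finally show ?thesis by (simp only: tt)
  qed
  ultimately have "cj P \<in> special_unitary n"
    by (simp add: special_unitary_def cj_adjoint cj_mult PP cj_one det_cj)
  moreover have "cj P * cj P = 1\<^sub>m n" by (simp add: cj_mult PP cj_one)
  moreover have "cj P * A * (cj P * A) = 1\<^sub>m n"
  proof -
    have "P * mat_diag n d * (P * mat_diag n d) = P * mat_diag n d * P * mat_diag n d"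
      by (simp add: assoc)
    also have "\<dots> = mat_diag n (\<lambda>i. d (\<sigma> i) * d i)" by (simp add: conjP)
    also have "\<dots> = mat_diag n (\<lambda>i. 1)" by (rule mat_diag_cong) (simp add: d\<sigma> cnj_d)
    finally show ?thesis unfolding A_eq by (simp add: cj_mult cj_one)
  qed
  moreover define k where "k i = (if d i = 1 then 0 else 1 / (1 - d i))" for i
  define e :: "nat \<Rightarrow> complex" where "e i = (if d i = 1 then 1 else 0)" for i
  have add_diag: "mat_diag n f + mat_diag n g = mat_diag n (\<lambda>i. f i + g i)" for f g :: "nat \<Rightarrow> complex"
    by (rule eq_matI) (auto simp: mat_diag_def)
  have "A * cj (mat_diag n k) + 1\<^sub>m n = cj (mat_diag n k) + cj (mat_diag n e)"
  proof -
    \<comment> \<open>Entrywise this says \<open>(1 - d i) * k i = 1 - e i\<close>.\<close>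
    have "mat_diag n d * mat_diag n k + mat_diag n (\<lambda>_. 1) = mat_diag n k + mat_diag n e"
      unfolding mat_diag_diag add_diag
      by (rule mat_diag_cong) (auto simp: k_def e_def field_simps)
    moreover have "A * cj (mat_diag n k) + 1\<^sub>m n = cj (mat_diag n d * mat_diag n k + mat_diag n (\<lambda>_. 1))"
      unfolding A_eq by (simp add: cj_mult cj_add cj_one)
    ultimately show ?thesis by (simp add: cj_add)
  qed
  moreover have "A * cj (mat_diag n e) = cj (mat_diag n e)"
  proof -
    have "mat_diag n (\<lambda>i. d i * e i) = mat_diag n e" by (rule mat_diag_cong) (auto simp: e_def)
    then show ?thesis unfolding A_eq by (simp add: cj_mult)
  qed
  moreover have "cj P * cj (mat_diag n e) = - cj (mat_diag n e)"
  proof -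
    have "Q * mat_diag n (\<lambda>i. s i * e i) = - mat_diag n e"
      unfolding mat_diag_mult_right[OF Q]
    proof (rule eq_matI)
      fix i j assume "i < dim_row (- mat_diag n e)" "j < dim_col (- mat_diag n e)"
      then have ij: "i < n" "j < n" by (auto simp: mat_diag_def)
      \<comment> \<open>Only columns \<open>j\<close> with \<open>d j = 1\<close> matter; there
        \<sigma> fixes \<open>j\<close>, and since \<open>j\<close> differs from \<open>i0\<close>
        the sign is still -1.\<close>
      have "d i0 \<noteq> 1" using i0 by simp
      then show "mat n n (\<lambda>(i, j). Q $$ (i, j) * (s j * e j)) $$ (i, j) = (- mat_diag n e) $$ (i, j)"
        using ij fix\<sigma>[of j] by (auto simp: Q_def involution_mat_def mat_diag_def e_def s_def s0_def)
    qed (auto simp: mat_diag_def)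
    then have "P * mat_diag n e = - mat_diag n e"
      by (simp add: P_def assoc)
    then show ?thesis by (simp add: cj_mult cj_uminus)
  qed
  ultimately show ?thesis
    by (intro exI[of _ "cj P"] exI[of _ "cj (mat_diag n k)"] exI[of _ "cj (mat_diag n e)"]) simp
qed

end

section \<open>The affine group\<close>

text \<open>An involution \<open>h\<close> equals its inverse, so the reversing equation says that
  \<open>h g h\<close> is inverse to \<open>g\<close>, that is, that \<open>h g\<close> squares to
  one. In this form no inverse in the affine group has to be computed.\<close>

lemma strongly_reversible_iff_product_of_involutions:
  assumes "group G" "g \<in> carrier G"
  shows "strongly_reversible G g \<longleftrightarrow>
    (\<exists>h \<in> carrier G. h \<otimes>\<^bsub>G\<^esub> h = \<one>\<^bsub>G\<^esub> \<and> h \<otimes>\<^bsub>G\<^esub> g \<otimes>\<^bsub>G\<^esub> (h \<otimes>\<^bsub>G\<^esub> g) = \<one>\<^bsub>G\<^esub>)"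
proof -
  interpret group G by fact
  have "h \<otimes>\<^bsub>G\<^esub> g \<otimes>\<^bsub>G\<^esub> inv\<^bsub>G\<^esub> h = inv\<^bsub>G\<^esub> g \<longleftrightarrow> h \<otimes>\<^bsub>G\<^esub> g \<otimes>\<^bsub>G\<^esub> (h \<otimes>\<^bsub>G\<^esub> g) = \<one>\<^bsub>G\<^esub>"
    if h: "h \<in> carrier G" "h \<otimes>\<^bsub>G\<^esub> h = \<one>\<^bsub>G\<^esub>" for h
  proof -
    have "inv\<^bsub>G\<^esub> h = h" using h by (simp add: inv_equality)
    moreover have "h \<otimes>\<^bsub>G\<^esub> g \<otimes>\<^bsub>G\<^esub> h = inv\<^bsub>G\<^esub> g \<longleftrightarrow> h \<otimes>\<^bsub>G\<^esub> g \<otimes>\<^bsub>G\<^esub> h \<otimes>\<^bsub>G\<^esub> g = \<one>\<^bsub>G\<^esub>"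
      using h assms(2) by (metis inv_equality l_inv m_closed)
    ultimately show ?thesis using h assms(2) by (simp add: m_assoc)
  qed
  then show ?thesis
    using assms(2) unfolding strongly_reversible_def by (auto simp: numeral_2_eq_2)
qed

text \<open>The cancellations of the following computation, in the shapes in which they occur
  there.\<close>

lemma vec_cancel:
  fixes x y z u :: "'a :: comm_ring_1 vec"
  assumes "x \<in> carrier_vec n" "y \<in> carrier_vec n" "z \<in> carrier_vec n" "u \<in> carrier_vec n"
  shows "x - y + (y - x) = 0\<^sub>v n" "x = y + x - y" "x - y - - z = x - y + z"
    "x + - z - y + (u - x) = u - y - z" "x - y + z + (y - x - z) = 0\<^sub>v n"
  by (intro eq_vecI; use assms in auto)+

text \<open>In coordinates centred at \<open>c\<close>, the map \<open>g\<close> is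
  \<open>z \<mapsto> A z + e\<close> and \<open>h\<close>, with translation part
  \<open>c - B c\<close>, is the linear map \<open>B\<close>. So \<open>h g\<close> is
  \<open>z \<mapsto> B A z - e\<close>, and the translation part of its square is
  \<open>- B A e - e = 0\<close>. The two conclusions say this in the original coordinates.\<close>

lemma SU_affine_reversing_involution:
  fixes A B :: "complex mat"
  assumes A: "A \<in> carrier_mat n n" and B: "B \<in> carrier_mat n n"
    and c: "c \<in> carrier_vec n" and e: "e \<in> carrier_vec n" and w: "w \<in> carrier_vec n"
    and BB: "B * B = 1\<^sub>m n" and BABA: "B * A * (B * A) = 1\<^sub>m n"
    and Ae: "A *\<^sub>v e = e" and Be: "B *\<^sub>v e = - e" and split: "A *\<^sub>v c + w = c + e"
  shows "B *\<^sub>v (c - B *\<^sub>v c) + (c - B *\<^sub>v c) = 0\<^sub>v n"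
    "B * A *\<^sub>v (B *\<^sub>v w + (c - B *\<^sub>v c)) + (B *\<^sub>v w + (c - B *\<^sub>v c)) = 0\<^sub>v n"
proof -
  have Bc: "B *\<^sub>v c \<in> carrier_vec n" and Ac: "A *\<^sub>v c \<in> carrier_vec n"
    and BAc: "B *\<^sub>v (A *\<^sub>v c) \<in> carrier_vec n" using A B c by auto
  have BBx: "B *\<^sub>v (B *\<^sub>v x) = x" if "x \<in> carrier_vec n" for x
    using assoc_mult_mat_vec[OF B B that] by (simp add: BB that)
  show "B *\<^sub>v (c - B *\<^sub>v c) + (c - B *\<^sub>v c) = 0\<^sub>v n"
    unfolding mult_minus_distrib_mat_vec[OF B c Bc] BBx[OF c]
    by (rule vec_cancel(1)[OF Bc c c c])
  have w_eq: "w = c + e - A *\<^sub>v c"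
    unfolding split[symmetric] by (rule vec_cancel(2)[OF w Ac w w])
  \<comment> \<open>The translation part of \<open>h g\<close>, rewritten so that \<open>w\<close>
    disappears.\<close>
  have Bw: "B *\<^sub>v w + (c - B *\<^sub>v c) = c - B *\<^sub>v (A *\<^sub>v c) - e"
    unfolding w_eq mult_minus_distrib_mat_vec[OF B add_carrier_vec[OF c e] Ac]
      mult_add_distrib_mat_vec[OF B c e] Be
    by (rule vec_cancel(4)[OF Bc BAc e c])
  have BAB: "B *\<^sub>v (A *\<^sub>v (B *\<^sub>v (A *\<^sub>v c))) = c"
  proof -
    have "B *\<^sub>v (A *\<^sub>v (B *\<^sub>v (A *\<^sub>v c))) = B * A * (B * A) *\<^sub>v c"
      using A B c Ac BAc by (simp add: assoc_mult_mat_vec[of _ n n _ n])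
    then show ?thesis using c by (simp add: BABA)
  qed
  have ABAc: "A *\<^sub>v (B *\<^sub>v (A *\<^sub>v c)) \<in> carrier_vec n" using A BAc by auto
  \<comment> \<open>The linear part \<open>B A\<close> sends this translation vector to its
    negative.\<close>
  have "B * A *\<^sub>v (c - B *\<^sub>v (A *\<^sub>v c) - e) = B *\<^sub>v (A *\<^sub>v c - A *\<^sub>v (B *\<^sub>v (A *\<^sub>v c)) - e)"
    using A B c e BAc
    by (simp add: assoc_mult_mat_vec[OF A B] mult_minus_distrib_mat_vec[OF A] assoc_mult_mat_vec[of B n n A n] Ae)
  also have "\<dots> = B *\<^sub>v (A *\<^sub>v c) - c + e"
    unfolding mult_minus_distrib_mat_vec[OF B minus_carrier_vec[OF Ac ABAc] e]
      mult_minus_distrib_mat_vec[OF B Ac ABAc] BAB Be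
    by (rule vec_cancel(3)[OF BAc c e e])
  finally show "B * A *\<^sub>v (B *\<^sub>v w + (c - B *\<^sub>v c)) + (B *\<^sub>v w + (c - B *\<^sub>v c)) = 0\<^sub>v n"
    unfolding Bw by (simp only:) (rule vec_cancel(5)[OF BAc c e e])
qed

theorem corollary1p7:
  fixes n :: nat and A :: "complex mat" and w :: "complex vec"
  assumes "(A, w) \<in> carrier (SU_affine n)"
    and "eigenvalue A (-1)"
  shows "strongly_reversible (SU_affine n) (A, w) \<longleftrightarrow> self_dual (char_poly A)"
proof -
  have A: "A \<in> special_unitary n" and w: "w \<in> carrier_vec n"
    using assms(1) by (auto simp: SU_affine_def)
  have Ac: "A \<in> carrier_mat n n" and AU: "A \<in> unitary_mats n"
    using A by (auto simp: special_unitary_def unitary_mats_def)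
  obtain U d where U: "U \<in> unitary_mats n" and d: "mat_adjoint U * A * U = mat_diag n d"
    using unitary_diagonalizable[OF AU] by blast
  interpret unitary_diag n A U d by unfold_locales (fact AU U d)+
  \<comment> \<open>For \<open>h = (B, v)\<close>, each of the two involution conditions splits into
    a linear part and a translation part.\<close>
  have iff: "strongly_reversible (SU_affine n) (A, w) \<longleftrightarrow>
    (\<exists>B \<in> special_unitary n. \<exists>v \<in> carrier_vec n.
      B * B = 1\<^sub>m n \<and> B *\<^sub>v v + v = 0\<^sub>v n \<and>
      B * A * (B * A) = 1\<^sub>m n \<and> B * A *\<^sub>v (B *\<^sub>v w + v) + (B *\<^sub>v w + v) = 0\<^sub>v n)"
    unfolding strongly_reversible_iff_product_of_involutions[OF group_SU_affine assms(1)]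
    by (auto simp: SU_affine_def)
  show ?thesis
  proof
    assume "strongly_reversible (SU_affine n) (A, w)"
    then obtain B where B: "B \<in> carrier_mat n n" "B * B = 1\<^sub>m n" "B * A * (B * A) = 1\<^sub>m n"
      unfolding iff by (auto simp: special_unitary_def)
    \<comment> \<open>Inserting \<open>A * mat_adjoint A\<close> completes \<open>B A B\<close> to
      \<open>B A B A = 1\<close>; as \<open>B\<close> is its own inverse, the result is a similarity
      of \<open>A\<close> and its adjoint.\<close>
    have "B * A * B = B * A * B * (A * mat_adjoint A)" using B Ac by (simp add: a(4))
    also have "\<dots> = B * A * (B * A) * mat_adjoint A" using B(1) a by (simp add: assoc)
    finally have "mat_adjoint A = B * A * B" using a(2) by (simp add: B(3))
    then have "similar_mat_wit (mat_adjoint A) A B B"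
      using B Ac a(2) by (intro similar_mat_witI[of _ _ n]) auto
    then show "self_dual (char_poly A)"
      by (intro self_dual_if_similar_adjoint) (auto simp: similar_mat_def)
  next
    assume "self_dual (char_poly A)"
    moreover obtain i0 where "i0 < n" "d i0 = -1"
      using assms(2) root_char_poly[of "-1"] eigenvalue_root_char_poly[OF Ac] by blast
    ultimately obtain B K E where B: "B \<in> special_unitary n"
      and K: "K \<in> carrier_mat n n" and E: "E \<in> carrier_mat n n"
      and BB: "B * B = 1\<^sub>m n" and BABA: "B * A * (B * A) = 1\<^sub>m n"
      and KE: "A * K + 1\<^sub>m n = K + E" and AE: "A * E = E" and BE: "B * E = - E"
      using reversing_involution_exists by blast
    have Bc: "B \<in> carrier_mat n n" using B by (simp add: special_unitary_def)
    have Kw: "K *\<^sub>v w \<in> carrier_vec n" and Ew: "E *\<^sub>v w \<in> carrier_vec n" using K E w by auto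
    have "A *\<^sub>v (E *\<^sub>v w) = E *\<^sub>v w" using assoc_mult_mat_vec[OF Ac E w] by (simp add: AE)
    moreover have "B *\<^sub>v (E *\<^sub>v w) = - (E *\<^sub>v w)"
      using assoc_mult_mat_vec[OF Bc E w] E w by (simp add: BE)
    moreover have "A *\<^sub>v (K *\<^sub>v w) + w = K *\<^sub>v w + E *\<^sub>v w"
    proof -
      have "A *\<^sub>v (K *\<^sub>v w) + w = (A * K + 1\<^sub>m n) *\<^sub>v w"
        using Ac K w by (simp add: add_mult_distrib_mat_vec[of _ n n])
      also have "\<dots> = K *\<^sub>v w + E *\<^sub>v w"
        unfolding KE by (rule add_mult_distrib_mat_vec[OF K E w])
      finally show ?thesis .
    qed
    \<comment> \<open>The centre is \<open>c = K w\<close> and the remaining translation, fixed by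
      \<open>A\<close> and reversed by \<open>B\<close>, is \<open>e = E w\<close>.\<close>
    ultimately have v: "B *\<^sub>v (K *\<^sub>v w - B *\<^sub>v (K *\<^sub>v w)) + (K *\<^sub>v w - B *\<^sub>v (K *\<^sub>v w)) = 0\<^sub>v n"
      "B * A *\<^sub>v (B *\<^sub>v w + (K *\<^sub>v w - B *\<^sub>v (K *\<^sub>v w)))
        + (B *\<^sub>v w + (K *\<^sub>v w - B *\<^sub>v (K *\<^sub>v w))) = 0\<^sub>v n"
      using SU_affine_reversing_involution[OF Ac Bc Kw Ew w BB BABA] by blast+
    have "K *\<^sub>v w - B *\<^sub>v (K *\<^sub>v w) \<in> carrier_vec n" using Kw Bc by auto
    with B BB BABA v show "strongly_reversible (SU_affine n) (A, w)"
      unfolding iff by blast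
  qed
qed

end
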